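(* Let $X$ be a cyclic quandle of order $q\ge 3$, with standard generators $x,y$, and let $\phi:X\to\mathrm{Conj}(\mathrm{Aut}(\mathbb{C}^2))$ be a representation of $X$ that does not map the generators $x,y$ to scalar multiples of $(q-1)$-th roots of the identity. Then $\phi$ is reducible.
   Context: A quandle is a set $X$ with a binary operation $\triangleright$ such that every right multiplication $R_i:y\mapsto y\triangleright i$ is a bijection, $(x\triangleright y)\triangleright z=(x\triangleright z)\triangleright(y\triangleright z)$, and $x\triangleright x=x$. A finite quandle $X$ of cardinality $q>2$ is cyclic if every $R_i$ is a cycle of length $q-1$. Every cyclic quandle of order $q$ is isomorphic to an Alexander quandle $(\mathbb{F}_q,\alpha)$ ($q$ a prime power, $\alpha$ a primitive element of $\mathbb{F}_q$, operation $u\triangleright v=\alpha u+(1-\alpha)v$), equivalently to the quandle with generators $x,y$ and relations $ab^{q-1}=a$, $ab^k=ba^{\log_\alpha(1-\alpha^k)}$ for $(a,b)\in\{(x,y),(y,x)\}$, $1\le k\le q-2$; here $ab^k=(\cdots((a\triangleright b)\triangleright b)\cdots)\triangleright b$ ($k$ factors $b$) and $\log_\alpha r\in\{0,\dots,q-2\}$ satisfies $\alpha^{\log_\alpha r}=r$. The standard generators of $X$ are the elements corresponding to $x,y$ under such an isomorphism (in $(\mathbb{F}_q,\alpha)$ they are $0$ and $1$). $\mathrm{Conj}(G)$ is the group $G$ with quandle operation $g\triangleright h=hgh^{-1}$; a representation of $X$ on $V$ is a quandle homomorphism $X\to\mathrm{Conj}(\mathrm{Aut}(V))$. A $(q-1)$-th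 root of the identity is a matrix $R$ with $R^{q-1}=I$; thus a matrix $A$ is a scalar multiple of such a root exactly when $A^{q-1}$ is a scalar multiple of the identity (the images of $x$ and $y$ are conjugate, so this holds for both or for neither). A subrepresentation is a linear subspace invariant under all $\phi(z)$; $\phi$ is irreducible if its only subrepresentations are $\{0\}$ and $V$, and reducible otherwise. *)

theory Defs
  imports
    "HOL-Analysis.Analysis"
    "HOL-Algebra.Multiplicative_Group"
    "HOL-Combinatorics.Cycles"
begin

section \<open>Quandles\<close>

record 'a quandle_struct = "'a partial_object" +
  qop :: "['a, 'a] \<Rightarrow> 'a"  (infixl \<open>\<rhd>\<index>\<close> 70)

locale quandle =
  fixes X :: "('a, 'm) quandle_struct_scheme" (structure)
  assumes right_mult_bij: "i \<in> carrier X \<Longrightarrow> bij_betw (\<lambda>y. y \<rhd> i) (carrier X) (carrier X)"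
    and self_distrib:
      "\<lbrakk>x \<in> carrier X; y \<in> carrier X; z \<in> carrier X\<rbrakk> \<Longrightarrow> (x \<rhd> y) \<rhd> z = (x \<rhd> z) \<rhd> (y \<rhd> z)"
    and idem: "x \<in> carrier X \<Longrightarrow> x \<rhd> x = x"

definition quandle_hom ::
    "('a, 'm) quandle_struct_scheme \<Rightarrow> ('b, 'n) quandle_struct_scheme \<Rightarrow> ('a \<Rightarrow> 'b) set" where
  "quandle_hom X Y = {h \<in> carrier X \<rightarrow> carrier Y.
     \<forall>a\<in>carrier X. \<forall>b\<in>carrier X. h (a \<rhd>\<^bsub>X\<^esub> b) = h a \<rhd>\<^bsub>Y\<^esub> h b}"

definition quandle_iso ::
    "('a, 'm) quandle_struct_scheme \<Rightarrow> ('b, 'n) quandle_struct_scheme \<Rightarrow> ('a \<Rightarrow> 'b) set" where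
  "quandle_iso X Y = {h \<in> quandle_hom X Y. bij_betw h (carrier X) (carrier Y)}"

text \<open>
  The function \<^term>\<open>cycle_of_list cs\<close> permutes the entries of \<^term>\<open>cs\<close> cyclically and fixes
  every other point.
\<close>

definition is_cycle_on :: "'a set \<Rightarrow> nat \<Rightarrow> ('a \<Rightarrow> 'a) \<Rightarrow> bool" where
  "is_cycle_on A n f \<longleftrightarrow>
     (\<exists>cs. cycle cs \<and> length cs = n \<and> set cs \<subseteq> A \<and> (\<forall>y\<in>A. f y = cycle_of_list cs y))"

definition cyclic_quandle :: "('a, 'm) quandle_struct_scheme \<Rightarrow> bool" where
  "cyclic_quandle X \<longleftrightarrow>
     quandle X \<and> finite (carrier X) \<and> card (carrier X) > 2 \<and>
     (\<forall>i\<in>carrier X. is_cycle_on (carrier X) (card (carrier X) - 1) (\<lambda>y. y \<rhd>\<^bsub>X\<^esub> i))"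


section \<open>Alexander quandles and standard generators\<close>

definition Alexander :: "('f, 'm) ring_scheme \<Rightarrow> 'f \<Rightarrow> 'f quandle_struct" where
  "Alexander F \<alpha> = \<lparr>carrier = carrier F,
     qop = (\<lambda>u v. (\<alpha> \<otimes>\<^bsub>F\<^esub> u) \<oplus>\<^bsub>F\<^esub> ((\<one>\<^bsub>F\<^esub> \<ominus>\<^bsub>F\<^esub> \<alpha>) \<otimes>\<^bsub>F\<^esub> v))\<rparr>"

definition primitive_element :: "('f, 'm) ring_scheme \<Rightarrow> 'f \<Rightarrow> bool" where
  "primitive_element F \<alpha> \<longleftrightarrow>
     \<alpha> \<in> carrier (mult_of F) \<and> carrier (mult_of F) = {\<alpha> [^]\<^bsub>F\<^esub> k | k::nat. k \<in> UNIV}"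

text \<open>
  The finite field is taken with carrier a set of natural numbers only because HOL cannot
  quantify over types; every finite field has an isomorphic copy of this form, so the
  existential ranges over all Alexander quandles of finite fields up to isomorphism.
\<close>

definition standard_generators ::
    "('a, 'm) quandle_struct_scheme \<Rightarrow> 'a \<Rightarrow> 'a \<Rightarrow> bool" where
  "standard_generators X x y \<longleftrightarrow> x \<in> carrier X \<and> y \<in> carrier X \<and>
     (\<exists>(F :: nat ring) \<alpha> h. field F \<and> finite (carrier F) \<and> primitive_element F \<alpha> \<and>
        h \<in> quandle_iso X (Alexander F \<alpha>) \<and> h x = \<zero>\<^bsub>F\<^esub> \<and> h y = \<one>\<^bsub>F\<^esub>)"


section \<open>Representations\<close>

definition Conj :: "('g, 'm) monoid_scheme \<Rightarrow> 'g quandle_struct" where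
  "Conj G = \<lparr>carrier = carrier G, qop = (\<lambda>g h. h \<otimes>\<^bsub>G\<^esub> g \<otimes>\<^bsub>G\<^esub> inv\<^bsub>G\<^esub> h)\<rparr>"

text \<open>
  The group of linear automorphisms of \<open>\<complex>\<^sup>n\<close>, whose elements are given by their matrices in
  the standard basis.
\<close>

definition Aut :: "(complex ^ 'n ^ 'n) monoid" where
  "Aut = \<lparr>carrier = {A. invertible A}, mult = (**), one = mat 1\<rparr>"

definition quandle_rep ::
    "('a, 'm) quandle_struct_scheme \<Rightarrow> ('a \<Rightarrow> complex ^ 'n ^ 'n) \<Rightarrow> bool" where
  "quandle_rep X \<phi> \<longleftrightarrow> \<phi> \<in> quandle_hom X (Conj Aut)"

definition subrepresentation ::
    "('a, 'm) quandle_struct_scheme \<Rightarrow> ('a \<Rightarrow> complex ^ 'n ^ 'n) \<Rightarrow> (complex ^ 'n) set \<Rightarrow> bool" where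
  "subrepresentation X \<phi> W \<longleftrightarrow>
     vec.subspace W \<and> (\<forall>z\<in>carrier X. \<forall>w\<in>W. \<phi> z *v w \<in> W)"

definition irreducible_rep ::
    "('a, 'm) quandle_struct_scheme \<Rightarrow> ('a \<Rightarrow> complex ^ 'n ^ 'n) \<Rightarrow> bool" where
  "irreducible_rep X \<phi> \<longleftrightarrow> (\<forall>W. subrepresentation X \<phi> W \<longrightarrow> W = {0} \<or> W = UNIV)"

definition reducible_rep ::
    "('a, 'm) quandle_struct_scheme \<Rightarrow> ('a \<Rightarrow> complex ^ 'n ^ 'n) \<Rightarrow> bool" where
  "reducible_rep X \<phi> \<longleftrightarrow> \<not> irreducible_rep X \<phi>"

text \<open>
  The power operation on \<^typ>\<open>complex ^ 'n ^ 'n\<close> inherited from the type class is entrywise, so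
  powers are taken in \<^const>\<open>Aut\<close>; this power is iterated \<open>**\<close> for every matrix,
  invertible or not.
\<close>

definition root_of_identity :: "nat \<Rightarrow> complex ^ 'n ^ 'n \<Rightarrow> bool" where
  "root_of_identity m R \<longleftrightarrow> R [^]\<^bsub>Aut\<^esub> m = mat 1"

definition scalar_multiple_of_root :: "nat \<Rightarrow> complex ^ 'n ^ 'n \<Rightarrow> bool" where
  "scalar_multiple_of_root m A \<longleftrightarrow> (\<exists>c R. root_of_identity m R \<and> A = map_matrix (\<lambda>r. c * r) R)"

end

theory Submission
  imports Defs
begin

text \<open>
  Since \<open>R\<^sub>b\<close> is a cycle of length \<open>q - 1\<close>, we have \<open>a b\<^sup>q\<^sup>-\<^sup>1 = a\<close> for all \<open>a\<close>, \<open>b\<close>, so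
  \<open>\<phi>(b)\<^sup>q\<^sup>-\<^sup>1\<close> commutes with the whole image of \<open>\<phi>\<close>. If it is not scalar, then any of its
  eigenspaces is a proper nonzero subrepresentation.
\<close>

text \<open>On the entries of \<open>cs\<close>, the \<open>k\<close>-th power of the cycle acts as
  rotation of the list by \<open>k\<close>, and rotation by the full length is the identity. Points
  off the list are fixed at every step.\<close>

lemma cycle_of_list_funpow_length:
  assumes "cycle cs"
  shows "(cycle_of_list cs ^^ length cs) a = a"
proof (cases "a \<in> set cs")
  case True
  have "map (cycle_of_list cs ^^ length cs) cs = map id cs"
    using cyclic_rotation[OF assms, of "length cs"] by simp
  with True show ?thesis
    by (metis id_apply map_eq_conv)
next
  case False
  have "(cycle_of_list cs ^^ k) a = a" for k
    by (induction k) (simp_all add: id_outside_supp[OF False])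
  then show ?thesis .
qed

lemma is_cycle_on_funpow:
  assumes "is_cycle_on A n f" and "f ` A \<subseteq> A" and "a \<in> A"
  shows "(f ^^ n) a = a"
proof -
  obtain cs where cs: "cycle cs" "length cs = n" "\<And>b. b \<in> A \<Longrightarrow> f b = cycle_of_list cs b"
    using assms(1) unfolding is_cycle_on_def by blast
  \<comment> \<open>\<open>f\<close> is known to agree with the cycle on \<open>A\<close> only, so
    the induction also has to keep the iterates inside \<open>A\<close>.\<close>
  have "(f ^^ k) a \<in> A \<and> (f ^^ k) a = (cycle_of_list cs ^^ k) a" for k
    using assms(2,3) cs(3) by (induction k) auto
  then show ?thesis
    using cycle_of_list_funpow_length[OF cs(1)] cs(2) by metis
qed

lemma Aut_simps [simp]:
  "carrier Aut = {A. invertible A}" "mult Aut = (**)" "one Aut = mat 1"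
  by (simp_all add: Aut_def)

lemma group_Aut: "group (Aut :: (complex ^ 'n ^ 'n) monoid)"
proof (rule groupI)
  fix A :: "complex ^ 'n ^ 'n"
  assume "A \<in> carrier Aut"
  then obtain B where "A ** B = mat 1" "B ** A = mat 1"
    by (auto simp: invertible_def)
  then show "\<exists>B\<in>carrier Aut. B \<otimes>\<^bsub>Aut\<^esub> A = \<one>\<^bsub>Aut\<^esub>"
    by (auto simp: invertible_def)
qed (auto simp: invertible_mult matrix_mul_assoc invertible_def[of "mat 1"])

lemma Aut_pow_scaled:
  "map_matrix ((*) c) A [^]\<^bsub>Aut\<^esub> (k::nat) = map_matrix ((*) (c ^ k)) (A [^]\<^bsub>Aut\<^esub> k)"
proof (induction k)
  case 0
  show ?case by (simp add: map_matrix_def vec_eq_iff)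
next
  case (Suc k)
  then show ?case
    by (simp add: map_matrix_def matrix_matrix_mult_def vec_eq_iff sum_distrib_left mult_ac)
qed

text \<open>Over the complex numbers \<open>c\<close> has an \<open>m\<close>-th root
  \<open>d\<close>. It is nonzero because \<open>mat c\<close>, being a power of an invertible
  matrix, is invertible. Dividing \<open>A\<close> by \<open>d\<close> then gives an
  \<open>m\<close>-th root of the identity.\<close>

lemma scalar_multiple_of_root_if_pow_scalar:
  fixes A :: "complex ^ 'n ^ 'n"
  assumes "invertible A" and "m > 0" and pow: "A [^]\<^bsub>Aut\<^esub> m = mat c"
  shows "scalar_multiple_of_root m A"
proof -
  interpret group "Aut :: (complex ^ 'n ^ 'n) monoid" by (rule group_Aut)
  have "invertible (mat c :: complex ^ 'n ^ 'n)"
    using nat_pow_closed[of A m] assms(1) pow by simp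
  then obtain B where "mat c ** B = (mat 1 :: complex ^ 'n ^ 'n)"
    by (auto simp: invertible_def)
  moreover have "mat 1 \<noteq> (0 :: complex ^ 'n ^ 'n)"
    by (simp add: mat_def vec_eq_iff)
  ultimately have "c \<noteq> 0"
    by auto
  define d where "d = c powr (1 / of_nat m)"
  \<comment> \<open>In this form the factors \<open>m\<close> and \<open>1/m\<close> cancel, leaving
    \<open>exp (Ln c) = c\<close>.\<close>
  have "d ^ m = exp (of_nat m * (1 / of_nat m * Ln c))"
    unfolding exp_of_nat_mult using \<open>c \<noteq> 0\<close> by (simp add: d_def powr_def)
  with \<open>c \<noteq> 0\<close> \<open>m > 0\<close> have d: "d ^ m = c" "d \<noteq> 0"
    by (auto simp: d_def)
  have "root_of_identity m (map_matrix ((*) (1 / d)) A)"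
    using d \<open>c \<noteq> 0\<close> unfolding root_of_identity_def Aut_pow_scaled pow
    by (simp add: map_matrix_def mat_def vec_eq_iff power_one_over)
  moreover have "A = map_matrix ((*) d) (map_matrix ((*) (1 / d)) A)"
    using d by (simp add: map_matrix_def vec_eq_iff)
  ultimately show ?thesis
    unfolding scalar_multiple_of_root_def by blast
qed

lemma complex_2x2_has_eigenvector:
  fixes M :: "complex ^ 2 ^ 2"
  obtains c v where "v \<noteq> 0" "M *v v = c *s v"
proof -
  \<comment> \<open>With \<open>t\<close> the trace, the characteristic polynomial is X^2 - tX + det
    M; \<open>c\<close> is the root that the quadratic formula gives, \<open>s\<close> being a
    square root of the discriminant.\<close>
  define t where "t = M$1$1 + M$2$2"
  define s where "s = csqrt (t\<^sup>2 - 4 * det M)"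
  define c where "c = (t + s) / 2"
  have "s\<^sup>2 = t\<^sup>2 - 4 * det M" by (simp add: s_def)
  moreover have "c\<^sup>2 - t * c = (s\<^sup>2 - t\<^sup>2) / 4"
    unfolding c_def by (simp add: field_simps power2_eq_square)
  moreover have "det (M - mat c) = c\<^sup>2 - t * c + det M"
    by (simp add: det_2 t_def mat_def power2_eq_square algebra_simps)
  ultimately have "det (M - mat c) = 0"
    by simp
  then have "\<not> invertible (M - mat c)"
    by (simp add: invertible_det_nz)
  then obtain v where "v \<noteq> 0" "(M - mat c) *v v = 0"
    using matrix_left_invertible_ker[of "M - mat c"] by (auto simp: invertible_left_inverse)
  moreover have "mat c *v v = c *s v"
    by (simp add: vec_eq_iff matrix_vector_mult_def mat_def if_distrib[of "\<lambda>x. x * _"] cong: if_cong)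
  ultimately show thesis
    using that by (simp add: matrix_vector_mult_diff_rdistrib)
qed

text \<open>A matrix commuting with \<open>M\<close> maps each eigenspace of \<open>M\<close> into
  itself. The eigenspace for \<open>c\<close> contains \<open>v\<close>, and if it were the whole
  space then \<open>M\<close> would equal \<open>mat c\<close>. The eigenvector is assumed, which
  keeps the dimension arbitrary.\<close>

lemma reducible_rep_if_commuting:
  fixes M :: "complex ^ 'n ^ 'n"
  assumes comm: "\<And>z. z \<in> carrier X \<Longrightarrow> M ** \<phi> z = \<phi> z ** M"
    and v: "v \<noteq> 0" "M *v v = c *s v"
    and "M \<noteq> mat c"
  shows "reducible_rep X \<phi>"
proof -
  define W where "W = {w. M *v w = c *s w}"
  have "vec.subspace W"
    by (auto simp: W_def vec.subspace_def matrix_vector_right_distrib vector_add_ldistrib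
        vector_smult_assoc vec.scale mult.commute)
  moreover have "\<phi> z *v w \<in> W" if "z \<in> carrier X" "w \<in> W" for z w
  proof -
    have "M *v (\<phi> z *v w) = \<phi> z *v (M *v w)"
      using comm[OF that(1)] by (simp add: matrix_vector_mul_assoc)
    also have "\<dots> = c *s (\<phi> z *v w)"
      using that(2) by (simp add: W_def vec.scale)
    finally show ?thesis by (simp add: W_def)
  qed
  ultimately have "subrepresentation X \<phi> W"
    by (simp add: subrepresentation_def)
  moreover have "W \<noteq> {0}"
    using v by (auto simp: W_def)
  moreover have "W \<noteq> UNIV"
  proof
    assume "W = UNIV"
    then have "M *v w = mat c *v w" for w
      by (auto simp: W_def vec_eq_iff matrix_vector_mult_def mat_def
          if_distrib[of "\<lambda>x. x * _"] cong: if_cong)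
    then show False
      using \<open>M \<noteq> mat c\<close> matrix_eq by blast
  qed
  ultimately show ?thesis
    unfolding reducible_rep_def irreducible_rep_def by blast
qed

text \<open>A homomorphism into \<open>Conj\<close> turns each right multiplication by
  \<open>b\<close> into conjugation by \<open>\<phi> b\<close>, so \<open>k\<close> of them become
  conjugation by the \<open>k\<close>-th power. The relation is multiplied out to avoid
  inverses.\<close>

lemma quandle_rep_funpow:
  fixes \<phi> :: "'a \<Rightarrow> complex ^ 'n ^ 'n"
  assumes "quandle X" and rep: "quandle_rep X \<phi>" and "a \<in> carrier X" and b: "b \<in> carrier X"
  shows "\<phi> (((\<lambda>y. y \<rhd>\<^bsub>X\<^esub> b) ^^ k) a) ** (\<phi> b [^]\<^bsub>Aut\<^esub> k) = (\<phi> b [^]\<^bsub>Aut\<^esub> k) ** \<phi> a"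
proof -
  interpret quandle X by fact
  interpret group "Aut :: (complex ^ 'n ^ 'n) monoid" by (rule group_Aut)
  have inv: "invertible (\<phi> z)" if "z \<in> carrier X" for z
    using rep that by (auto simp: quandle_rep_def quandle_hom_def Conj_def)
  have step: "\<phi> (z \<rhd>\<^bsub>X\<^esub> b) ** \<phi> b = \<phi> b ** \<phi> z" if "z \<in> carrier X" for z
  proof -
    have "\<phi> (z \<rhd>\<^bsub>X\<^esub> b) = \<phi> b ** \<phi> z ** inv\<^bsub>Aut\<^esub> \<phi> b"
      using rep that b by (auto simp: quandle_rep_def quandle_hom_def Conj_def)
    then show ?thesis
      using l_inv[of "\<phi> b"] inv[OF b] by (simp flip: matrix_mul_assoc)
  qed
  have closed: "((\<lambda>y. y \<rhd>\<^bsub>X\<^esub> b) ^^ k) a \<in> carrier X" for k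
    using \<open>a \<in> carrier X\<close> right_mult_bij[OF b] by (induction k) (auto simp: bij_betw_def)
  show ?thesis
  proof (induction k)
    case 0
    show ?case by simp
  next
    case (Suc k)
    let ?z = "((\<lambda>y. y \<rhd>\<^bsub>X\<^esub> b) ^^ k) a" and ?P = "\<phi> b [^]\<^bsub>Aut\<^esub> k"
    \<comment> \<open>The power recursion adds its new factor on the right, but \<open>step\<close>
      needs \<open>\<phi> b\<close> directly after \<open>\<phi> (?z \<rhd> b)\<close>, hence on the
      left.\<close>
    have pow: "\<phi> b [^]\<^bsub>Aut\<^esub> Suc k = \<phi> b ** ?P"
      using nat_pow_Suc2[of "\<phi> b" k] inv[OF b] by simp
    have "\<phi> (?z \<rhd>\<^bsub>X\<^esub> b) ** (\<phi> b ** ?P) = \<phi> b ** (\<phi> ?z ** ?P)"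
      using step[OF closed, of k] by (simp add: matrix_mul_assoc)
    then show ?case
      unfolding pow by (simp add: Suc.IH matrix_mul_assoc)
  qed
qed

lemma cyclic_quandle_rep_pow_central:
  fixes \<phi> :: "'a \<Rightarrow> complex ^ 'n ^ 'n"
  assumes cyc: "cyclic_quandle X" and rep: "quandle_rep X \<phi>"
    and ab: "a \<in> carrier X" "b \<in> carrier X"
  defines "P \<equiv> \<phi> b [^]\<^bsub>Aut\<^esub> (card (carrier X) - 1)"
  shows "P ** \<phi> a = \<phi> a ** P"
proof -
  interpret quandle X
    using cyc by (simp add: cyclic_quandle_def)
  \<comment> \<open>Once the iterate returns to \<open>a\<close>, the intertwining relation for
    powers becomes commutation. The case \<open>a = b\<close> is included.\<close>
  have "((\<lambda>y. y \<rhd>\<^bsub>X\<^esub> b) ^^ (card (carrier X) - 1)) a = a"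
  proof (rule is_cycle_on_funpow)
    show "is_cycle_on (carrier X) (card (carrier X) - 1) (\<lambda>y. y \<rhd>\<^bsub>X\<^esub> b)"
      using cyc ab by (simp add: cyclic_quandle_def)
  qed (use right_mult_bij ab in \<open>auto simp: bij_betw_def\<close>)
  then show ?thesis
    using quandle_rep_funpow[OF quandle_axioms rep ab, of "card (carrier X) - 1"]
    by (simp add: P_def)
qed

theorem proposition6p2:
  fixes X :: "('a, 'm) quandle_struct_scheme"
    and q :: nat
    and x y :: 'a
    and \<phi> :: "'a \<Rightarrow> complex ^ 2 ^ 2"
  assumes "cyclic_quandle X"
    and "card (carrier X) = q"
    and "q \<ge> 3"
    and "standard_generators X x y"
    and "quandle_rep X \<phi>"
    and "\<not> (scalar_multiple_of_root (q - 1) (\<phi> x) \<and> scalar_multiple_of_root (q - 1) (\<phi> y))"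
  shows "reducible_rep X \<phi>"
proof -
  \<comment> \<open>\<open>b\<close> is \<open>x\<close> or \<open>y\<close>, whichever violates the
    root condition.\<close>
  obtain b where b: "b \<in> carrier X" and nonroot: "\<not> scalar_multiple_of_root (q - 1) (\<phi> b)"
    using assms(4,6) unfolding standard_generators_def by blast
  let ?M = "\<phi> b [^]\<^bsub>Aut\<^esub> (q - 1)"
  obtain c v where v: "v \<noteq> 0" "?M *v v = c *s v"
    by (rule complex_2x2_has_eigenvector)
  have "invertible (\<phi> b)"
    using assms(5) b by (auto simp: quandle_rep_def quandle_hom_def Conj_def)
  then have "?M \<noteq> mat c"
    using scalar_multiple_of_root_if_pow_scalar[of "\<phi> b" "q - 1" c] nonroot \<open>q \<ge> 3\<close> by auto
  moreover have "?M ** \<phi> z = \<phi> z ** ?M" if "z \<in> carrier X" for z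
    using cyclic_quandle_rep_pow_central[OF assms(1,5) that b] assms(2) by simp
  ultimately show ?thesis
    using reducible_rep_if_commuting[OF _ v] by blast
qed

end
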